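(* Let $g$ be a harmonic critical metric on a compact manifold $M$ of dimension $n\ge 3$, let $\theta$ be a smooth 1-form satisfying $E_g=B_g^*\theta-\frac{n-2}{2n}\bar s_g\,g$, and let $f\in C^\infty(M)$ satisfy $$\mathrm{Ric}_g+\mathrm{Hess}_g f=\lambda g,\qquad \lambda=\frac{\bar s_g}{n}.$$ Then $$\theta=-df+\eta,$$ where $\eta$ is a 1-form such that $\eta^\#$ is a Killing vector field.
   Context: Notation: $\mathrm{Ric}_g$ is the Ricci tensor, $s_g$ the scalar curvature, $E_g=\mathrm{Ric}_g-\frac12 s_g g$ the Einstein tensor, $\bar s_g=\frac{1}{\mathrm{Vol}(M,g)}\int_M s_g\,dv_g$ the average scalar curvature, and $\eta^\#$ the vector field $g$-dual to $\eta$. For a 1-form $\theta$: $\delta\theta=-\nabla^i\theta_i$, $(\delta^*\theta)_{ij}=\frac12(\nabla_i\theta_j+\nabla_j\theta_i)$, and $B_g^*\theta=\delta^*\theta+\frac12(\delta\theta)g$. $\mathrm{Hess}_g f=\nabla df$. A Riemannian metric $g$ on a compact $n$-manifold is called harmonic critical if there exists a smooth 1-form $\theta$ (called a gauge one-form) such that $E_g=B_g^*\theta-\frac{n-2}{2n}\bar s_g\,g$. *)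

theory Defs
  imports "HOL-Analysis.Analysis"
begin

section \<open>Smooth functions on open subsets of Euclidean space\<close>

definition partial_deriv :: "'n::finite \<Rightarrow> (real^'n \<Rightarrow> real) \<Rightarrow> real^'n \<Rightarrow> real" where
  "partial_deriv i f x = frechet_derivative f (at x) (axis i 1)"

text \<open>Meaningful for open \<open>S\<close> only.\<close>

primrec Ck_on :: "nat \<Rightarrow> (real^'n::finite) set \<Rightarrow> (real^'n \<Rightarrow> real) \<Rightarrow> bool" where
  "Ck_on 0 S f \<longleftrightarrow> continuous_on S f"
| "Ck_on (Suc k) S f \<longleftrightarrow>
     (\<forall>x\<in>S. f differentiable (at x)) \<and> (\<forall>i. Ck_on k S (partial_deriv i f))"

definition smooth_on :: "(real^'n::finite) set \<Rightarrow> (real^'n \<Rightarrow> real) \<Rightarrow> bool" where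
  "smooth_on S f \<longleftrightarrow> (\<forall>k. Ck_on k S f)"

section \<open>Compact smooth manifolds\<close>

text \<open>A chart is a pair of its domain and its coordinate map; the coordinate map is only
  relevant on the domain. The dimension of the manifold is \<open>CARD('n)\<close>.\<close>

type_synonym ('a, 'n) chart = "'a set \<times> ('a \<Rightarrow> real^'n)"

abbreviation dom_chart :: "('a, 'n::finite) chart \<Rightarrow> 'a set" where
  "dom_chart c \<equiv> fst c"

abbreviation coord :: "('a, 'n::finite) chart \<Rightarrow> 'a \<Rightarrow> real^'n" where
  "coord c \<equiv> snd c"

definition image_chart :: "('a, 'n::finite) chart \<Rightarrow> (real^'n) set" where
  "image_chart c = coord c ` dom_chart c"

definition inv_chart :: "('a, 'n::finite) chart \<Rightarrow> real^'n \<Rightarrow> 'a" where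
  "inv_chart c = inv_into (dom_chart c) (coord c)"

definition is_chart :: "'a topology \<Rightarrow> ('a, 'n::finite) chart \<Rightarrow> bool" where
  "is_chart X c \<longleftrightarrow> openin X (dom_chart c) \<and> open (image_chart c) \<and>
     homeomorphic_map (subtopology X (dom_chart c)) (top_of_set (image_chart c)) (coord c)"

definition smooth_compatible :: "('a, 'n::finite) chart \<Rightarrow> ('a, 'n) chart \<Rightarrow> bool" where
  "smooth_compatible c c' \<longleftrightarrow>
     (\<forall>a. smooth_on (coord c ` (dom_chart c \<inter> dom_chart c'))
            (\<lambda>x. coord c' (inv_chart c x) $ a))"

definition smooth_atlas :: "'a topology \<Rightarrow> ('a, 'n::finite) chart set \<Rightarrow> bool" where
  "smooth_atlas X A \<longleftrightarrow> (\<forall>c\<in>A. is_chart X c) \<and> (\<Union>c\<in>A. dom_chart c) = topspace X \<and>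
     (\<forall>c\<in>A. \<forall>c'\<in>A. smooth_compatible c c')"

text \<open>Second countability is automatic, since finitely many chart domains cover \<open>X\<close>.\<close>

definition compact_manifold :: "'a topology \<Rightarrow> ('a, 'n::finite) chart set \<Rightarrow> bool" where
  "compact_manifold X A \<longleftrightarrow> Hausdorff_space X \<and> compact_space X \<and> smooth_atlas X A"

definition smooth_in_chart :: "('a, 'n::finite) chart \<Rightarrow> ('a \<Rightarrow> real) \<Rightarrow> bool" where
  "smooth_in_chart c h \<longleftrightarrow> smooth_on (image_chart c) (h \<circ> inv_chart c)"

definition smooth_function :: "('a, 'n::finite) chart set \<Rightarrow> ('a \<Rightarrow> real) \<Rightarrow> bool" where
  "smooth_function A f \<longleftrightarrow> (\<forall>c\<in>A. smooth_in_chart c f)"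

text \<open>\<open>pd c i h p\<close> is \<open>(\<partial>h/\<partial>x\<^sup>i)(p)\<close>, where \<open>x\<close> are the coordinates of the chart \<open>c\<close>.\<close>

definition pd :: "('a, 'n::finite) chart \<Rightarrow> 'n \<Rightarrow> ('a \<Rightarrow> real) \<Rightarrow> 'a \<Rightarrow> real" where
  "pd c i h p = partial_deriv i (h \<circ> inv_chart c) (coord c p)"

section \<open>Tensor fields\<close>

text \<open>A tensor field assigns to each chart \<open>c\<close> and point \<open>p\<close> of its domain the components at
  \<open>p\<close> with respect to the coordinate frame of \<open>c\<close>, subject to the tensorial change-of-chart
  law. Values at points outside the domain of \<open>c\<close> are irrelevant.\<close>

type_synonym ('a, 'n) vec_field = "('a, 'n) chart \<Rightarrow> 'a \<Rightarrow> real^'n"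
type_synonym ('a, 'n) mat_field = "('a, 'n) chart \<Rightarrow> 'a \<Rightarrow> real^'n^'n"

text \<open>\<open>jacobian c c' p $ a $ i\<close> is \<open>\<partial>x'\<^sup>a/\<partial>x\<^sup>i\<close> at \<open>p\<close>.\<close>

definition jacobian :: "('a, 'n::finite) chart \<Rightarrow> ('a, 'n) chart \<Rightarrow> 'a \<Rightarrow> real^'n^'n" where
  "jacobian c c' p = (\<chi> a i. pd c i (\<lambda>q. coord c' q $ a) p)"

definition smooth_one_form :: "('a, 'n::finite) chart set \<Rightarrow> ('a, 'n) vec_field \<Rightarrow> bool" where
  "smooth_one_form A \<theta> \<longleftrightarrow>
     (\<forall>c\<in>A. \<forall>i. smooth_in_chart c (\<lambda>p. \<theta> c p $ i)) \<and>
     (\<forall>c\<in>A. \<forall>c'\<in>A. \<forall>p\<in>dom_chart c \<inter> dom_chart c'. \<forall>i.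
        \<theta> c p $ i = (\<Sum>a\<in>UNIV. \<theta> c' p $ a * jacobian c c' p $ a $ i))"

definition smooth_vector_field :: "('a, 'n::finite) chart set \<Rightarrow> ('a, 'n) vec_field \<Rightarrow> bool" where
  "smooth_vector_field A V \<longleftrightarrow>
     (\<forall>c\<in>A. \<forall>i. smooth_in_chart c (\<lambda>p. V c p $ i)) \<and>
     (\<forall>c\<in>A. \<forall>c'\<in>A. \<forall>p\<in>dom_chart c \<inter> dom_chart c'. \<forall>a.
        V c' p $ a = (\<Sum>i\<in>UNIV. jacobian c c' p $ a $ i * V c p $ i))"

definition smooth_covariant2 :: "('a, 'n::finite) chart set \<Rightarrow> ('a, 'n) mat_field \<Rightarrow> bool" where
  "smooth_covariant2 A h \<longleftrightarrow>
     (\<forall>c\<in>A. \<forall>i j. smooth_in_chart c (\<lambda>p. h c p $ i $ j)) \<and>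
     (\<forall>c\<in>A. \<forall>c'\<in>A. \<forall>p\<in>dom_chart c \<inter> dom_chart c'. \<forall>i j.
        h c p $ i $ j = (\<Sum>a\<in>UNIV. \<Sum>b\<in>UNIV.
          h c' p $ a $ b * jacobian c c' p $ a $ i * jacobian c c' p $ b $ j))"

definition riemannian_metric :: "('a, 'n::finite) chart set \<Rightarrow> ('a, 'n) mat_field \<Rightarrow> bool" where
  "riemannian_metric A g \<longleftrightarrow> smooth_covariant2 A g \<and>
     (\<forall>c\<in>A. \<forall>p\<in>dom_chart c. (\<forall>i j. g c p $ i $ j = g c p $ j $ i) \<and>
        (\<forall>v. v \<noteq> 0 \<longrightarrow> v \<bullet> (g c p *v v) > 0))"

definition differential :: "('a \<Rightarrow> real) \<Rightarrow> ('a, 'n::finite) vec_field" where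
  "differential f c p = (\<chi> i. pd c i f p)"

definition sharp :: "('a, 'n::finite) mat_field \<Rightarrow> ('a, 'n) vec_field \<Rightarrow> ('a, 'n) vec_field" where
  "sharp g \<eta> c p = matrix_inv (g c p) *v \<eta> c p"

section \<open>Levi-Civita connection and curvature\<close>

text \<open>\<open>christoffel g c p k i j\<close> is \<open>\<Gamma>\<^sup>k\<^sub>i\<^sub>j\<close>.\<close>

definition christoffel ::
    "('a, 'n::finite) mat_field \<Rightarrow> ('a, 'n) chart \<Rightarrow> 'a \<Rightarrow> 'n \<Rightarrow> 'n \<Rightarrow> 'n \<Rightarrow> real" where
  "christoffel g c p k i j = (\<Sum>l\<in>UNIV. matrix_inv (g c p) $ k $ l *
      (pd c i (\<lambda>q. g c q $ j $ l) p + pd c j (\<lambda>q. g c q $ i $ l) p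
       - pd c l (\<lambda>q. g c q $ i $ j) p)) / 2"

text \<open>The \<open>(i, j)\<close> entry of \<open>cov_deriv g \<theta> c p\<close> is \<open>\<nabla>\<^sub>i\<theta>\<^sub>j\<close>.\<close>

definition cov_deriv :: "('a, 'n::finite) mat_field \<Rightarrow> ('a, 'n) vec_field \<Rightarrow> ('a, 'n) mat_field" where
  "cov_deriv g \<theta> c p = (\<chi> i j. pd c i (\<lambda>q. \<theta> c q $ j) p
      - (\<Sum>k\<in>UNIV. christoffel g c p k i j * \<theta> c p $ k))"

definition hess :: "('a, 'n::finite) mat_field \<Rightarrow> ('a \<Rightarrow> real) \<Rightarrow> ('a, 'n) mat_field" where
  "hess g f = cov_deriv g (differential f)"

text \<open>\<open>riemann g c p l k i j\<close> is the coefficient of \<open>\<partial>\<^sub>l\<close> in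
  \<open>\<nabla>\<^sub>i\<nabla>\<^sub>j\<partial>\<^sub>k - \<nabla>\<^sub>j\<nabla>\<^sub>i\<partial>\<^sub>k\<close>; the contraction over \<open>l = i\<close> below then gives the unit
  sphere positive Ricci curvature.\<close>

definition riemann ::
    "('a, 'n::finite) mat_field \<Rightarrow> ('a, 'n) chart \<Rightarrow> 'a \<Rightarrow> 'n \<Rightarrow> 'n \<Rightarrow> 'n \<Rightarrow> 'n \<Rightarrow> real" where
  "riemann g c p l k i j =
      pd c i (\<lambda>q. christoffel g c q l j k) p - pd c j (\<lambda>q. christoffel g c q l i k) p
      + (\<Sum>m\<in>UNIV. christoffel g c p l i m * christoffel g c p m j k
                   - christoffel g c p l j m * christoffel g c p m i k)"

definition ricci :: "('a, 'n::finite) mat_field \<Rightarrow> ('a, 'n) mat_field" where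
  "ricci g c p = (\<chi> j k. \<Sum>l\<in>UNIV. riemann g c p l k l j)"

definition metric_trace ::
    "('a, 'n::finite) mat_field \<Rightarrow> ('a, 'n) mat_field \<Rightarrow> ('a, 'n) chart \<Rightarrow> 'a \<Rightarrow> real" where
  "metric_trace g h c p = (\<Sum>i\<in>UNIV. \<Sum>j\<in>UNIV. matrix_inv (g c p) $ i $ j * h c p $ i $ j)"

text \<open>Scalar curvature computed in the chart \<open>c\<close>; its value at \<open>p\<close> does not depend on the
  chart, which is what makes the function \<open>scalar_curvature\<close> on the manifold well defined.\<close>

definition scal :: "('a, 'n::finite) mat_field \<Rightarrow> ('a, 'n) chart \<Rightarrow> 'a \<Rightarrow> real" where
  "scal g = metric_trace g (ricci g)"

definition scalar_curvature ::
    "('a, 'n::finite) chart set \<Rightarrow> ('a, 'n) mat_field \<Rightarrow> 'a \<Rightarrow> real" where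
  "scalar_curvature A g p = scal g (SOME c. c \<in> A \<and> p \<in> dom_chart c) p"

definition einstein :: "('a, 'n::finite) mat_field \<Rightarrow> ('a, 'n) mat_field" where
  "einstein g c p = ricci g c p - (scal g c p / 2) *\<^sub>R g c p"

section \<open>Riemannian volume and average scalar curvature\<close>

text \<open>The Riemannian measure is the unique Borel measure whose expression in each chart is
  \<open>sqrt (det g) dx\<close>: uniqueness holds because finitely many chart domains cover the compact
  space, existence by the change-of-variables formula.\<close>

definition riemannian_measure ::
    "'a topology \<Rightarrow> ('a, 'n::finite) chart set \<Rightarrow> ('a, 'n) mat_field \<Rightarrow> 'a measure" where
  "riemannian_measure X A g = (THE \<mu>.
     space \<mu> = topspace X \<and>
     sets \<mu> = sigma_sets (topspace X) {U. openin X U} \<and>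
     (\<forall>c\<in>A. \<forall>B\<in>sets \<mu>. B \<subseteq> dom_chart c \<longrightarrow>
        emeasure \<mu> B =
          (\<integral>\<^sup>+x\<in>coord c ` B. ennreal (sqrt (det (g c (inv_chart c x)))) \<partial>lborel)))"

definition avg_scal ::
    "'a topology \<Rightarrow> ('a, 'n::finite) chart set \<Rightarrow> ('a, 'n) mat_field \<Rightarrow> real" where
  "avg_scal X A g =
     integral\<^sup>L (riemannian_measure X A g) (scalar_curvature A g)
       / measure (riemannian_measure X A g) (topspace X)"

section \<open>Harmonic critical metrics and Killing fields\<close>

definition codiff :: "('a, 'n::finite) mat_field \<Rightarrow> ('a, 'n) vec_field \<Rightarrow> ('a, 'n) chart \<Rightarrow> 'a \<Rightarrow> real"
  where "codiff g \<theta> c p = - metric_trace g (cov_deriv g \<theta>) c p"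

definition codiff_adj :: "('a, 'n::finite) mat_field \<Rightarrow> ('a, 'n) vec_field \<Rightarrow> ('a, 'n) mat_field" where
  "codiff_adj g \<theta> c p = (\<chi> i j. (cov_deriv g \<theta> c p $ i $ j + cov_deriv g \<theta> c p $ j $ i) / 2)"

definition bianchi_adj :: "('a, 'n::finite) mat_field \<Rightarrow> ('a, 'n) vec_field \<Rightarrow> ('a, 'n) mat_field" where
  "bianchi_adj g \<theta> c p = codiff_adj g \<theta> c p + (codiff g \<theta> c p / 2) *\<^sub>R g c p"

definition gauge_one_form ::
    "'a topology \<Rightarrow> ('a, 'n::finite) chart set \<Rightarrow> ('a, 'n) mat_field \<Rightarrow> ('a, 'n) vec_field \<Rightarrow> bool" where
  "gauge_one_form X A g \<theta> \<longleftrightarrow> smooth_one_form A \<theta> \<and>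
     (\<forall>c\<in>A. \<forall>p\<in>dom_chart c. einstein g c p = bianchi_adj g \<theta> c p
        - ((real CARD('n) - 2) / (2 * real CARD('n)) * avg_scal X A g) *\<^sub>R g c p)"

definition harmonic_critical ::
    "'a topology \<Rightarrow> ('a, 'n::finite) chart set \<Rightarrow> ('a, 'n) mat_field \<Rightarrow> bool" where
  "harmonic_critical X A g \<longleftrightarrow> riemannian_metric A g \<and> (\<exists>\<theta>. gauge_one_form X A g \<theta>)"

definition lie_deriv_metric ::
    "('a, 'n::finite) mat_field \<Rightarrow> ('a, 'n) vec_field \<Rightarrow> ('a, 'n) mat_field" where
  "lie_deriv_metric g V c p = (\<chi> i j. \<Sum>k\<in>UNIV.
      V c p $ k * pd c k (\<lambda>q. g c q $ i $ j) p
      + g c p $ k $ j * pd c i (\<lambda>q. V c q $ k) p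
      + g c p $ i $ k * pd c j (\<lambda>q. V c q $ k) p)"

definition killing_field ::
    "('a, 'n::finite) chart set \<Rightarrow> ('a, 'n) mat_field \<Rightarrow> ('a, 'n) vec_field \<Rightarrow> bool" where
  "killing_field A g V \<longleftrightarrow> smooth_vector_field A V \<and>
     (\<forall>c\<in>A. \<forall>p\<in>dom_chart c. lie_deriv_metric g V c p = 0)"

end

theory Submission
  imports Defs
begin

text \<open>
  Put \<open>\<eta> = \<theta> + df\<close>. The vector field \<open>\<eta>\<^sup>#\<close> is Killing if and only if \<open>\<delta>\<^sup>*\<eta> = 0\<close>, because the Lie
  derivative of \<open>g\<close> along \<open>\<eta>\<^sup>#\<close> is \<open>2 \<delta>\<^sup>*\<eta>\<close> (lemma \<open>lie_deriv_metric_sharp\<close>). Now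
  \<open>\<delta>\<^sup>*\<eta> = \<delta>\<^sup>*\<theta> + Hess f\<close>, and the soliton equation says that \<open>Hess f = \<lambda>g - Ric\<close>. It remains to
  see that \<open>\<delta>\<^sup>*\<theta> = Ric - \<lambda>g\<close>, which is the gauge equation after eliminating \<open>\<delta>\<theta>\<close>: with \<open>s\<close> the
  scalar curvature and \<open>s\<^sub>0\<close> its average, the trace of
  \<open>Ric - (s/2) g = \<delta>\<^sup>*\<theta> + (\<delta>\<theta>/2) g - ((n-2)/(2n)) s\<^sub>0 g\<close> gives \<open>\<delta>\<theta> = s\<^sub>0 - s\<close> when \<open>n \<noteq> 2\<close>, and
  substituting this back turns the multiples of \<open>g\<close> into \<open>- (s\<^sub>0/n) g = - \<lambda>g\<close> (lemma
  \<open>gauge_one_form_codiff_adj\<close>). The argument is pointwise.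

  Since tensor fields are families of components in charts, it must also be shown that \<open>\<eta>\<close> is a
  smooth one-form and \<open>\<eta>\<^sup>#\<close> a smooth vector field. The first is the chain rule for changes of
  charts (lemma \<open>pd_change_of_chart\<close>); the second follows from Cramer's rule and the transformation
  law of \<open>g\<close> (lemmas \<open>smooth_in_chart_sharp\<close> and \<open>smooth_vector_field_sharp\<close>).
\<close>

section \<open>Calculus of iterated partial derivatives\<close>

lemma partial_deriv_eq:
  assumes "(f has_derivative f') (at x)"
  shows "partial_deriv i f x = f' (axis i 1)"
  unfolding partial_deriv_def using frechet_derivative_at[OF assms] by simp

lemma partial_deriv_cong:
  assumes "open S" "x \<in> S" "\<And>y. y \<in> S \<Longrightarrow> f y = g y"
  shows "partial_deriv i f x = partial_deriv i g x"
proof -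
  have "(f has_derivative f') (at x) \<longleftrightarrow> (g has_derivative f') (at x)" for f'
    using has_derivative_transform_within_open[OF _ assms(1,2), of f f' UNIV g]
      has_derivative_transform_within_open[OF _ assms(1,2), of g f' UNIV f] assms(3) by auto
  then show ?thesis
    by (simp add: partial_deriv_def frechet_derivative_def)
qed

lemma differentiable_cong_open:
  assumes "open S" "x \<in> S" "\<And>y. y \<in> S \<Longrightarrow> f y = g y" "f differentiable (at x)"
  shows "g differentiable (at x)"
  using has_derivative_transform_within_open[OF _ assms(1,2), of f _ UNIV g] assms(3,4)
  unfolding differentiable_def by blast

lemma Ck_on_cong:
  assumes "open S" "\<And>y. y \<in> S \<Longrightarrow> f y = g y" "Ck_on k S f"
  shows "Ck_on k S g"
  using assms(2,3)
proof (induction k arbitrary: f g)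
  case 0
  then show ?case by (metis Ck_on.simps(1) continuous_on_cong)
next
  case (Suc k)
  have "Ck_on k S (partial_deriv i g)" for i
  proof (rule Suc.IH)
    show "partial_deriv i f x = partial_deriv i g x" if "x \<in> S" for x
      using partial_deriv_cong[OF assms(1) that Suc.prems(1)] .
    show "Ck_on k S (partial_deriv i f)" using Suc.prems(2) by simp
  qed
  moreover have "g differentiable (at x)" if "x \<in> S" for x
    using differentiable_cong_open[OF assms(1) that Suc.prems(1)] Suc.prems(2) that by simp
  ultimately show ?case by simp
qed

lemma Ck_on_SucD: "Ck_on (Suc k) S f \<Longrightarrow> Ck_on k S f"
proof (induction k arbitrary: f)
  case 0
  then show ?case
    by (auto intro!: continuous_at_imp_continuous_on differentiable_imp_continuous_within)
next
  case (Suc k)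
  then show ?case by (metis Ck_on.simps(2))
qed

lemma Ck_on_const: "Ck_on k S (\<lambda>x. c)"
proof (induction k arbitrary: c)
  case (Suc k)
  have "partial_deriv i (\<lambda>x. c) = (\<lambda>x. 0)" for i :: 'a
    by (rule ext) (simp add: partial_deriv_eq[OF has_derivative_const])
  with Suc show ?case by simp
qed simp

lemma Ck_on_add:
  assumes "open S"
  shows "Ck_on k S f \<Longrightarrow> Ck_on k S g \<Longrightarrow> Ck_on k S (\<lambda>x. f x + g x)"
proof (induction k arbitrary: f g)
  case 0
  then show ?case by (simp add: continuous_on_add)
next
  case (Suc k)
  have "Ck_on k S (partial_deriv i (\<lambda>x. f x + g x))" for i
  proof (rule Ck_on_cong[OF assms])
    show "Ck_on k S (\<lambda>x. partial_deriv i f x + partial_deriv i g x)"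
      using Suc by simp
    show "partial_deriv i f x + partial_deriv i g x = partial_deriv i (\<lambda>x. f x + g x) x"
      if "x \<in> S" for x
      using Suc.prems that
      by (subst partial_deriv_eq[OF has_derivative_add])
        (auto simp: partial_deriv_def frechet_derivative_works)
  qed
  with Suc.prems show ?case by simp
qed

text \<open>The Leibniz rule leaves the undifferentiated factors in place, so the induction needs
  them at the lower order as well.\<close>

lemma Ck_on_mult:
  assumes "open S"
  shows "Ck_on k S f \<Longrightarrow> Ck_on k S g \<Longrightarrow> Ck_on k S (\<lambda>x. f x * g x)"
proof (induction k arbitrary: f g)
  case 0
  then show ?case by (simp add: continuous_on_mult)
next
  case (Suc k)
  have "Ck_on k S (partial_deriv i (\<lambda>x. f x * g x))" for i
  proof (rule Ck_on_cong[OF assms])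
    show "Ck_on k S (\<lambda>x. f x * partial_deriv i g x + partial_deriv i f x * g x)"
    proof (rule Ck_on_add[OF assms])
      show "Ck_on k S (\<lambda>x. f x * partial_deriv i g x)"
        by (rule Suc.IH[OF Ck_on_SucD[OF Suc.prems(1)]]) (use Suc.prems(2) in simp)
      show "Ck_on k S (\<lambda>x. partial_deriv i f x * g x)"
        by (rule Suc.IH[OF _ Ck_on_SucD[OF Suc.prems(2)]]) (use Suc.prems(1) in simp)
    qed
    show "f x * partial_deriv i g x + partial_deriv i f x * g x = partial_deriv i (\<lambda>x. f x * g x) x"
      if "x \<in> S" for x
    proof -
      have "(f has_derivative frechet_derivative f (at x)) (at x)"
        "(g has_derivative frechet_derivative g (at x)) (at x)"
        using Suc.prems that by (simp_all add: frechet_derivative_works[symmetric])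
      then have "((\<lambda>x. f x * g x) has_derivative
          (\<lambda>h. f x * frechet_derivative g (at x) h + frechet_derivative f (at x) h * g x)) (at x)"
        by (rule has_derivative_mult)
      then have "partial_deriv i (\<lambda>x. f x * g x) x
          = f x * frechet_derivative g (at x) (axis i 1) + frechet_derivative f (at x) (axis i 1) * g x"
        by (rule partial_deriv_eq)
      then show ?thesis by (simp only: partial_deriv_def)
    qed
  qed
  moreover have "(\<lambda>x. f x * g x) differentiable (at x)" if "x \<in> S" for x
    using Suc.prems that by (intro differentiable_mult) simp_all
  ultimately show ?case by simp
qed

lemma Ck_on_inverse:
  assumes "open S" "\<And>x. x \<in> S \<Longrightarrow> f x \<noteq> 0"
  shows "Ck_on k S f \<Longrightarrow> Ck_on k S (\<lambda>x. inverse (f x))"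
proof (induction k)
  case 0
  then show ?case using assms by (simp add: continuous_on_inverse)
next
  case (Suc k)
  have inv: "Ck_on k S (\<lambda>x. inverse (f x))"
    by (rule Suc.IH[OF Ck_on_SucD[OF Suc.prems]])
  have "Ck_on k S (partial_deriv i (\<lambda>x. inverse (f x)))" for i
  proof (rule Ck_on_cong[OF assms(1)])
    show "Ck_on k S (\<lambda>x. - 1 * (inverse (f x) * partial_deriv i f x * inverse (f x)))"
      using Suc.prems inv by (intro Ck_on_mult[OF assms(1)] Ck_on_const) auto
    show "- 1 * (inverse (f x) * partial_deriv i f x * inverse (f x))
        = partial_deriv i (\<lambda>x. inverse (f x)) x"
      if "x \<in> S" for x
    proof -
      have "(f has_derivative frechet_derivative f (at x)) (at x)"
        using Suc.prems that by (simp add: frechet_derivative_works[symmetric])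
      then have "((\<lambda>x. inverse (f x)) has_derivative
          (\<lambda>h. - (inverse (f x) * frechet_derivative f (at x) h * inverse (f x)))) (at x)"
        by (rule Deriv.has_derivative_inverse[where f = f and x = x, OF assms(2)[OF that]])
      then have "partial_deriv i (\<lambda>x. inverse (f x)) x
          = - (inverse (f x) * frechet_derivative f (at x) (axis i 1) * inverse (f x))"
        by (rule partial_deriv_eq)
      then show ?thesis by (simp only: partial_deriv_def mult_minus1)
    qed
  qed
  moreover have "(\<lambda>x. inverse (f x)) differentiable (at x)" if "x \<in> S" for x
    using Suc.prems that assms(2) by (intro differentiable_inverse) simp_all
  ultimately show ?case by simp
qed

lemma smooth_on_differentiable:
  assumes "smooth_on S f" "x \<in> S"
  shows "f differentiable (at x)"
proof -
  have "Ck_on (Suc 0) S f" using assms by (simp only: smooth_on_def)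
  with assms(2) show ?thesis by simp
qed

lemma smooth_on_partial_deriv: "smooth_on S f \<Longrightarrow> smooth_on S (partial_deriv i f)"
  unfolding smooth_on_def by (metis Ck_on.simps(2))

lemma smooth_on_cong:
  assumes "open S" "\<And>y. y \<in> S \<Longrightarrow> f y = g y" "smooth_on S f"
  shows "smooth_on S g"
  using assms Ck_on_cong unfolding smooth_on_def by blast


section \<open>Coordinate calculus in a chart\<close>

lemma chart_open_image: "is_chart X c \<Longrightarrow> open (image_chart c)"
  by (simp add: is_chart_def)

lemma coord_in_image: "p \<in> dom_chart c \<Longrightarrow> coord c p \<in> image_chart c"
  by (simp add: image_chart_def)

lemma inv_chart_in_dom: "x \<in> image_chart c \<Longrightarrow> inv_chart c x \<in> dom_chart c"
  unfolding image_chart_def inv_chart_def by (rule inv_into_into)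

lemma coord_inv_chart: "x \<in> image_chart c \<Longrightarrow> coord c (inv_chart c x) = x"
  unfolding image_chart_def inv_chart_def by (rule f_inv_into_f)

lemma topspace_chart_domain:
  assumes "is_chart X c"
  shows "topspace (subtopology X (dom_chart c)) = dom_chart c"
  using assms openin_subset by (fastforce simp: is_chart_def)

lemma inv_chart_coord:
  assumes "is_chart X c" "p \<in> dom_chart c"
  shows "inv_chart c (coord c p) = p"
proof -
  have "inj_on (coord c) (topspace (subtopology X (dom_chart c)))"
    using assms(1) homeomorphic_imp_injective_map by (force simp: is_chart_def)
  then have "inj_on (coord c) (dom_chart c)"
    by (simp only: topspace_chart_domain[OF assms(1)])
  then show ?thesis
    using assms(2) by (simp add: inv_chart_def)
qed

lemma open_chart_overlap:
  assumes "is_chart X c" "is_chart X c'"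
  shows "open (coord c ` (dom_chart c \<inter> dom_chart c'))"
proof -
  let ?U = "dom_chart c \<inter> dom_chart c'"
  have "openin (subtopology X (dom_chart c)) ?U"
    using assms by (auto simp: is_chart_def openin_subtopology)
  moreover have "open_map (subtopology X (dom_chart c)) (top_of_set (image_chart c)) (coord c)"
    using assms(1) by (simp add: is_chart_def homeomorphic_imp_open_map)
  ultimately have "openin (top_of_set (image_chart c)) (coord c ` ?U)"
    by (auto simp: open_map_def)
  then show ?thesis
    using chart_open_image[OF assms(1)] openin_open_trans by blast
qed

lemma pd_cong:
  assumes "is_chart X c" "p \<in> dom_chart c" "\<And>q. q \<in> dom_chart c \<Longrightarrow> h q = h' q"
  shows "pd c i h p = pd c i h' p"
  unfolding pd_def
  by (rule partial_deriv_cong[OF chart_open_image[OF assms(1)] coord_in_image[OF assms(2)]])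
    (simp add: assms(3) inv_chart_in_dom)

lemma smooth_in_chart_cong:
  assumes "is_chart X c" "\<And>q. q \<in> dom_chart c \<Longrightarrow> h q = h' q" "smooth_in_chart c h"
  shows "smooth_in_chart c h'"
  using assms(3) unfolding smooth_in_chart_def
  by (rule smooth_on_cong[OF chart_open_image[OF assms(1)], rotated])
    (simp add: assms(2) inv_chart_in_dom)

lemma smooth_in_chart_const: "smooth_in_chart c (\<lambda>p. r)"
  by (simp add: smooth_in_chart_def smooth_on_def comp_def Ck_on_const)

lemma smooth_in_chart_add:
  "is_chart X c \<Longrightarrow> smooth_in_chart c h \<Longrightarrow> smooth_in_chart c k \<Longrightarrow> smooth_in_chart c (\<lambda>p. h p + k p)"
  using Ck_on_add[OF chart_open_image]
  by (fastforce simp: smooth_in_chart_def smooth_on_def comp_def)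

lemma smooth_in_chart_mult:
  "is_chart X c \<Longrightarrow> smooth_in_chart c h \<Longrightarrow> smooth_in_chart c k \<Longrightarrow> smooth_in_chart c (\<lambda>p. h p * k p)"
  using Ck_on_mult[OF chart_open_image]
  by (fastforce simp: smooth_in_chart_def smooth_on_def comp_def)

lemma smooth_in_chart_inverse:
  assumes "is_chart X c" "\<And>p. p \<in> dom_chart c \<Longrightarrow> h p \<noteq> 0" "smooth_in_chart c h"
  shows "smooth_in_chart c (\<lambda>p. inverse (h p))"
  using assms(3) Ck_on_inverse[OF chart_open_image[OF assms(1)], of "h \<circ> inv_chart c"]
  by (simp add: smooth_in_chart_def smooth_on_def comp_def assms(2) inv_chart_in_dom)

lemma smooth_in_chart_sum:
  assumes "is_chart X c" "\<And>i. i \<in> I \<Longrightarrow> smooth_in_chart c (h i)"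
  shows "smooth_in_chart c (\<lambda>p. \<Sum>i\<in>I. h i p)"
  using assms(2)
  by (induction I rule: infinite_finite_induct)
    (auto intro: smooth_in_chart_const smooth_in_chart_add[OF assms(1)])

lemma smooth_in_chart_prod:
  assumes "is_chart X c" "\<And>i. i \<in> I \<Longrightarrow> smooth_in_chart c (h i)"
  shows "smooth_in_chart c (\<lambda>p. \<Prod>i\<in>I. h i p)"
  using assms(2)
  by (induction I rule: infinite_finite_induct)
    (auto intro: smooth_in_chart_const smooth_in_chart_mult[OF assms(1)])

lemma smooth_in_chart_det:
  fixes G :: "'a \<Rightarrow> real^'m::finite^'m"
  assumes "is_chart X c" "\<And>i j. smooth_in_chart c (\<lambda>p. G p $ i $ j)"
  shows "smooth_in_chart c (\<lambda>p. det (G p))"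
  unfolding det_def
  by (intro smooth_in_chart_sum[OF assms(1)] smooth_in_chart_mult[OF assms(1)]
      smooth_in_chart_prod[OF assms(1)] smooth_in_chart_const assms(2))

lemma smooth_in_chart_pd:
  assumes "is_chart X c" "smooth_in_chart c h"
  shows "smooth_in_chart c (pd c i h)"
  unfolding smooth_in_chart_def
  by (rule smooth_on_cong[OF chart_open_image[OF assms(1)]
        _ smooth_on_partial_deriv[OF assms(2)[unfolded smooth_in_chart_def]]])
    (simp add: pd_def coord_inv_chart)

lemma smooth_in_chart_has_derivative:
  assumes "smooth_in_chart c h" "p \<in> dom_chart c"
  shows "((\<lambda>x. h (inv_chart c x)) has_derivative
    frechet_derivative (\<lambda>x. h (inv_chart c x)) (at (coord c p))) (at (coord c p))"
  using smooth_on_differentiable[OF assms(1)[unfolded smooth_in_chart_def] coord_in_image[OF assms(2)]]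
  by (simp add: frechet_derivative_works comp_def)

lemma pd_add:
  assumes "smooth_in_chart c h" "smooth_in_chart c k" "p \<in> dom_chart c"
  shows "pd c i (\<lambda>q. h q + k q) p = pd c i h p + pd c i k p"
  using partial_deriv_eq[OF has_derivative_add[OF smooth_in_chart_has_derivative[OF assms(1,3)]
        smooth_in_chart_has_derivative[OF assms(2,3)]]]
  by (simp add: pd_def comp_def) (simp add: partial_deriv_def)

lemma pd_mult:
  assumes "is_chart X c" "smooth_in_chart c h" "smooth_in_chart c k" "p \<in> dom_chart c"
  shows "pd c i (\<lambda>q. h q * k q) p = h p * pd c i k p + pd c i h p * k p"
  using partial_deriv_eq[OF has_derivative_mult[OF smooth_in_chart_has_derivative[OF assms(2,4)]
        smooth_in_chart_has_derivative[OF assms(3,4)]]]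
  by (simp add: pd_def comp_def inv_chart_coord[OF assms(1,4)]) (simp add: partial_deriv_def)

lemma pd_sum:
  assumes "finite I" "\<And>k. k \<in> I \<Longrightarrow> smooth_in_chart c (h k)" "p \<in> dom_chart c"
  shows "pd c i (\<lambda>q. \<Sum>k\<in>I. h k q) p = (\<Sum>k\<in>I. pd c i (h k) p)"
  using partial_deriv_eq[OF has_derivative_sum[of I, OF
        smooth_in_chart_has_derivative[OF assms(2) assms(3)]]]
  by (simp add: pd_def comp_def) (simp add: partial_deriv_def)

text \<open>This is the chain rule for \<open>f \<circ> inv_chart c = (f \<circ> inv_chart c') \<circ> \<phi>\<close> on the overlap, where
  \<open>\<phi>\<close> is the transition map \<open>coord c' \<circ> inv_chart c\<close>, whose derivative is the Jacobian. It makes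
  \<open>df\<close> a one-form.\<close>

lemma pd_change_of_chart:
  fixes c c' :: "('a, 'n::finite) chart"
  assumes "is_chart X c" "is_chart X c'" "smooth_compatible c c'" "smooth_in_chart c' f"
    and "p \<in> dom_chart c \<inter> dom_chart c'"
  shows "pd c i f p = (\<Sum>a\<in>UNIV. pd c' a f p * jacobian c c' p $ a $ i)"
proof -
  define W where "W = coord c ` (dom_chart c \<inter> dom_chart c')"
  define x where "x = coord c p"
  define \<phi> where "\<phi> = (\<lambda>y. coord c' (inv_chart c y))"
  define F where "F = f \<circ> inv_chart c'"
  define \<phi>' where "\<phi>' = (\<lambda>a. frechet_derivative (\<lambda>y. \<phi> y $ a) (at x))"
  define F' where "F' = frechet_derivative F (at (\<phi> x))"
  have p: "p \<in> dom_chart c" "p \<in> dom_chart c'" using assms(5) by auto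
  have W: "open W" "x \<in> W"
    using open_chart_overlap[OF assms(1,2)] assms(5) by (auto simp: W_def x_def)
  have \<phi>x: "\<phi> x = coord c' p"
    by (simp add: \<phi>_def x_def inv_chart_coord[OF assms(1) p(1)])
  have "((\<lambda>y. \<phi> y $ a) has_derivative \<phi>' a) (at x)" for a
  proof -
    have "smooth_on W (\<lambda>y. \<phi> y $ a)"
      using assms(3) by (simp add: smooth_compatible_def W_def \<phi>_def)
    then show ?thesis
      using smooth_on_differentiable W(2) by (auto simp: \<phi>'_def frechet_derivative_works[symmetric])
  qed
  then have d\<phi>: "(\<phi> has_derivative (\<lambda>h. \<chi> a. \<phi>' a h)) (at x)"
    by (subst has_derivative_componentwise_within)
      (auto simp: Basis_vec_def inner_axis)
  have dF: "(F has_derivative F') (at (\<phi> x))"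
    using smooth_in_chart_has_derivative[OF assms(4) p(2)]
    by (simp add: F_def F'_def \<phi>x comp_def)
  then have "linear F'" by (rule has_derivative_linear)
  have "F' (\<chi> a. \<phi>' a (axis i 1)) = F' (\<Sum>a\<in>UNIV. \<phi>' a (axis i 1) *\<^sub>R axis a 1)"
    using basis_expansion[of "\<chi> a. \<phi>' a (axis i 1)"] by (simp add: scalar_mult_eq_scaleR)
  also have "\<dots> = (\<Sum>a\<in>UNIV. \<phi>' a (axis i 1) * F' (axis a 1))"
    using \<open>linear F'\<close> by (simp add: linear_sum linear_cmul)
  finally have expand: "F' (\<chi> a. \<phi>' a (axis i 1)) = (\<Sum>a\<in>UNIV. \<phi>' a (axis i 1) * F' (axis a 1))" .
  have "pd c i f p = partial_deriv i (F \<circ> \<phi>) x"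
    unfolding pd_def x_def[symmetric]
    by (rule partial_deriv_cong[OF W])
      (auto simp: W_def F_def \<phi>_def inv_chart_coord[OF assms(1)] inv_chart_coord[OF assms(2)])
  also have "\<dots> = F' (\<chi> a. \<phi>' a (axis i 1))"
    using partial_deriv_eq[OF diff_chain_at[OF d\<phi> dF]] by simp
  also have "\<dots> = (\<Sum>a\<in>UNIV. pd c' a f p * jacobian c c' p $ a $ i)"
    unfolding expand
    by (simp add: pd_def jacobian_def partial_deriv_def F'_def F_def \<phi>'_def \<phi>x[symmetric] comp_def)
      (simp add: \<phi>_def x_def mult.commute)
  finally show ?thesis .
qed


section \<open>Symmetric positive definite matrices\<close>

lemma positive_definite_invertible:
  fixes G :: "real^'m::finite^'m"
  assumes "\<And>v. v \<noteq> 0 \<Longrightarrow> v \<bullet> (G *v v) > 0"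
  shows "invertible G"
proof -
  have "v = 0" if "G *v v = 0" for v
    using assms[of v] that by fastforce
  then show ?thesis
    by (simp add: invertible_left_inverse matrix_left_invertible_ker)
qed

lemma matrix_inv_mult:
  assumes "invertible G"
  shows "G ** matrix_inv G = mat 1" "matrix_inv G ** G = mat 1"
  using someI_ex[OF assms[unfolded invertible_def]] unfolding matrix_inv_def by auto

lemma matrix_inv_symmetric:
  fixes G :: "real^'m::finite^'m"
  assumes "invertible G" "transpose G = G"
  shows "transpose (matrix_inv G) = matrix_inv G"
proof -
  have "transpose (matrix_inv G) ** G = mat 1"
    using matrix_inv_mult(1)[OF assms(1)] assms(2) by (metis matrix_transpose_mul transpose_mat)
  then show ?thesis
    by (metis assms(1) matrix_inv_mult(1) matrix_mul_assoc matrix_mul_lid matrix_mul_rid)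
qed


section \<open>Raising indices, and the metric trace\<close>

locale riemannian_atlas =
  fixes X :: "'a topology" and A :: "('a, 'n::finite) chart set" and g :: "('a, 'n) mat_field"
  assumes atlas: "smooth_atlas X A" and metric: "riemannian_metric A g"
begin

lemma is_chart_atlas: "c \<in> A \<Longrightarrow> is_chart X c"
  using atlas by (simp add: smooth_atlas_def)

lemma smooth_metric: "c \<in> A \<Longrightarrow> smooth_in_chart c (\<lambda>p. g c p $ i $ j)"
  using metric by (simp add: riemannian_metric_def smooth_covariant2_def)

lemma metric_sym: "c \<in> A \<Longrightarrow> p \<in> dom_chart c \<Longrightarrow> g c p $ i $ j = g c p $ j $ i"
  using metric unfolding riemannian_metric_def by blast

lemma metric_invertible: "c \<in> A \<Longrightarrow> p \<in> dom_chart c \<Longrightarrow> invertible (g c p)"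
  using metric unfolding riemannian_metric_def by (blast intro: positive_definite_invertible)

lemma inverse_metric_sym:
  assumes "c \<in> A" "p \<in> dom_chart c"
  shows "matrix_inv (g c p) $ i $ j = matrix_inv (g c p) $ j $ i"
proof -
  have "transpose (g c p) = g c p"
    by (simp add: vec_eq_iff transpose_def metric_sym[OF assms])
  from matrix_inv_symmetric[OF metric_invertible[OF assms] this] show ?thesis
    by (metis transpose_def vec_lambda_beta)
qed

lemma metric_mult_sharp:
  assumes "c \<in> A" "p \<in> dom_chart c"
  shows "g c p *v sharp g \<eta> c p = \<eta> c p"
  by (simp add: sharp_def matrix_vector_mul_assoc matrix_inv_mult[OF metric_invertible[OF assms]])

lemma sharp_unique:
  assumes "c \<in> A" "p \<in> dom_chart c" "g c p *v v = \<eta> c p"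
  shows "sharp g \<eta> c p = v"
  by (simp add: sharp_def assms(3)[symmetric] matrix_vector_mul_assoc
      matrix_inv_mult[OF metric_invertible[OF assms(1,2)]])

text \<open>Cramer's rule writes the components of \<open>\<eta>\<^sup>#\<close> as quotients of polynomials in the
  components of \<open>g\<close> and \<open>\<eta>\<close>.\<close>

lemma smooth_in_chart_sharp:
  assumes "smooth_one_form A \<eta>" "c \<in> A"
  shows "smooth_in_chart c (\<lambda>p. sharp g \<eta> c p $ k)"
proof -
  note chart = is_chart_atlas[OF assms(2)]
  define num where "num = (\<lambda>p. det (\<chi> i j. if j = k then \<eta> c p $ i else g c p $ i $ j))"
  have det: "det (g c p) \<noteq> 0" if "p \<in> dom_chart c" for p
    using metric_invertible[OF assms(2) that] by (simp add: invertible_det_nz)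
  have \<eta>: "smooth_in_chart c (\<lambda>p. \<eta> c p $ i)" for i
    using assms by (simp add: smooth_one_form_def)
  have "smooth_in_chart c num"
    unfolding num_def
  proof (rule smooth_in_chart_det[OF chart])
    show "smooth_in_chart c (\<lambda>p. (\<chi> i j. if j = k then \<eta> c p $ i else g c p $ i $ j) $ i $ j)" for i j
      using \<eta>[of i] smooth_metric[OF assms(2), of i j] by (cases "j = k") simp_all
  qed
  moreover have "smooth_in_chart c (\<lambda>p. inverse (det (g c p)))"
    by (rule smooth_in_chart_inverse[OF chart det smooth_in_chart_det[OF chart]])
      (auto intro: smooth_metric[OF assms(2)])
  ultimately have "smooth_in_chart c (\<lambda>p. num p * inverse (det (g c p)))"
    by (rule smooth_in_chart_mult[OF chart])
  moreover have "num p * inverse (det (g c p)) = sharp g \<eta> c p $ k" if "p \<in> dom_chart c" for p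
    using metric_mult_sharp[OF assms(2) that] cramer[OF det[OF that]]
    by (simp add: num_def divide_inverse)
  ultimately show ?thesis
    by (rule smooth_in_chart_cong[OF chart, rotated])
qed

text \<open>With \<open>J\<close> the Jacobian, \<open>g = J\<^sup>T g' J\<close> forces \<open>J\<close> to be invertible. Cancelling \<open>J\<^sup>T\<close> in
  \<open>J\<^sup>T g' J \<eta>\<^sup># = g \<eta>\<^sup># = \<eta> = J\<^sup>T \<eta>'\<close> shows that \<open>J \<eta>\<^sup>#\<close> solves the equation that defines
  \<open>\<eta>'\<^sup>#\<close>.\<close>

lemma smooth_vector_field_sharp:
  assumes "smooth_one_form A \<eta>"
  shows "smooth_vector_field A (sharp g \<eta>)"
  unfolding smooth_vector_field_def
proof (intro conjI ballI allI)
  show "smooth_in_chart c (\<lambda>p. sharp g \<eta> c p $ k)" if "c \<in> A" for c k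
    using smooth_in_chart_sharp[OF assms that] .
next
  fix c c' p a
  assume c: "c \<in> A" "c' \<in> A" and "p \<in> dom_chart c \<inter> dom_chart c'"
  then have p: "p \<in> dom_chart c" "p \<in> dom_chart c'" by auto
  define J where "J = Defs.jacobian c c' p"
  have metric_change: "g c p = transpose J ** g c' p ** J"
  proof -
    have "g c p $ i $ j = (\<Sum>a\<in>UNIV. \<Sum>b\<in>UNIV. g c' p $ a $ b * J $ a $ i * J $ b $ j)" for i j
      using metric c p unfolding riemannian_metric_def smooth_covariant2_def J_def by blast
    moreover have "(transpose J ** g c' p ** J) $ i $ j
        = (\<Sum>b\<in>UNIV. \<Sum>a\<in>UNIV. g c' p $ a $ b * J $ a $ i * J $ b $ j)" for i j
      by (simp add: matrix_matrix_mult_def transpose_def sum_distrib_left sum_distrib_right mult_ac)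
    ultimately show ?thesis
      using sum.swap[of "\<lambda>a b. g c' p $ a $ b * J $ a $ i * J $ b $ j" UNIV UNIV for i j]
      by (simp add: vec_eq_iff)
  qed
  have form_change: "\<eta> c p = transpose J *v \<eta> c' p"
  proof -
    have "\<eta> c p $ i = (\<Sum>a\<in>UNIV. \<eta> c' p $ a * J $ a $ i)" for i
      using assms c p unfolding smooth_one_form_def J_def by blast
    then show ?thesis
      by (simp add: vec_eq_iff matrix_vector_mult_def transpose_def mult.commute)
  qed
  have "(matrix_inv (g c p) ** transpose J ** g c' p) ** J = mat 1"
    using matrix_inv_mult(2)[OF metric_invertible[OF c(1) p(1)]]
    by (simp add: metric_change matrix_mul_assoc)
  then have "invertible J"
    unfolding invertible_left_inverse by blast
  then have "inj ((*v) (transpose J))"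
    by (intro inj_matrix_vector_mult transpose_invertible)
  then have cancel: "u = v" if "transpose J *v u = transpose J *v v" for u v
    using that by (rule injD)
  have "transpose J *v (g c' p *v (J *v sharp g \<eta> c p)) = transpose J *v \<eta> c' p"
    using metric_mult_sharp[OF c(1) p(1), of \<eta>]
    by (simp add: metric_change form_change matrix_vector_mul_assoc matrix_mul_assoc)
  then have "sharp g \<eta> c' p = J *v sharp g \<eta> c p"
    by (rule sharp_unique[OF c(2) p(2) cancel])
  then show "sharp g \<eta> c' p $ a = (\<Sum>i\<in>UNIV. Defs.jacobian c c' p $ a $ i * sharp g \<eta> c p $ i)"
    by (simp add: matrix_vector_mult_def J_def)
qed

text \<open>The metric has trace equal to the dimension.\<close>

lemma metric_trace_add_multiple:
  assumes "c \<in> A" "p \<in> dom_chart c" "h c p = u c p + r *\<^sub>R g c p"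
  shows "metric_trace g h c p = metric_trace g u c p + r * real CARD('n)"
proof -
  let ?G = "matrix_inv (g c p)"
  have "(\<Sum>j\<in>UNIV. ?G $ i $ j * g c p $ i $ j) = 1" for i
  proof -
    have "(\<Sum>j\<in>UNIV. ?G $ i $ j * g c p $ i $ j) = (?G ** g c p) $ i $ i"
      by (simp add: matrix_matrix_mult_def metric_sym[OF assms(1,2), of i])
    then show ?thesis
      by (simp add: matrix_inv_mult[OF metric_invertible[OF assms(1,2)]] mat_def)
  qed
  then have "(\<Sum>i\<in>UNIV. \<Sum>j\<in>UNIV. ?G $ i $ j * g c p $ i $ j) = real CARD('n)"
    by simp
  moreover have "metric_trace g h c p
      = metric_trace g u c p + r * (\<Sum>i\<in>UNIV. \<Sum>j\<in>UNIV. ?G $ i $ j * g c p $ i $ j)"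
    by (simp add: metric_trace_def assms(3) sum_distrib_left flip: sum.distrib)
      (simp add: algebra_simps)
  ultimately show ?thesis by simp
qed

lemma metric_trace_codiff_adj:
  assumes "c \<in> A" "p \<in> dom_chart c"
  shows "metric_trace g (codiff_adj g \<theta>) c p = - codiff g \<theta> c p"
proof -
  let ?G = "matrix_inv (g c p)" and ?D = "cov_deriv g \<theta> c p"
  have "(\<Sum>i\<in>UNIV. \<Sum>j\<in>UNIV. ?G $ i $ j * ?D $ j $ i) = (\<Sum>i\<in>UNIV. \<Sum>j\<in>UNIV. ?G $ i $ j * ?D $ i $ j)"
    using sum.swap[of "\<lambda>i j. ?G $ i $ j * ?D $ j $ i" UNIV UNIV]
    by (simp add: inverse_metric_sym[OF assms])
  moreover have "metric_trace g (codiff_adj g \<theta>) c p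
      = ((\<Sum>i\<in>UNIV. \<Sum>j\<in>UNIV. ?G $ i $ j * ?D $ i $ j) + (\<Sum>i\<in>UNIV. \<Sum>j\<in>UNIV. ?G $ i $ j * ?D $ j $ i)) / 2"
    by (simp add: metric_trace_def codiff_adj_def sum_divide_distrib algebra_simps add_divide_distrib
        flip: sum.distrib)
  ultimately show ?thesis
    by (simp add: codiff_def metric_trace_def)
qed


section \<open>The gauge equation\<close>

text \<open>Taking traces in the gauge equation gives \<open>(n - 2) (\<delta>\<theta> + s - s\<^sub>0) = 0\<close>, where \<open>s\<^sub>0\<close> is the
  average scalar curvature; so \<open>\<delta>\<theta>\<close> can be eliminated from it when \<open>n \<noteq> 2\<close>.\<close>

lemma gauge_one_form_codiff_adj:
  assumes gauge: "gauge_one_form X A g \<theta>" and dim: "CARD('n) \<noteq> 2"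
    and "c \<in> A" "p \<in> dom_chart c"
  shows "codiff_adj g \<theta> c p = ricci g c p - (avg_scal X A g / real CARD('n)) *\<^sub>R g c p"
proof -
  note at = assms(3,4)
  define n where "n = real CARD('n)"
  define a where "a = avg_scal X A g"
  define s where "s = scal g c p"
  define d where "d = codiff g \<theta> c p"
  define k where "k = (n - 2) / (2 * n) * a"
  have n: "n > 0" "n \<noteq> 2"
    using dim by (auto simp: n_def)
  have eq: "einstein g c p = bianchi_adj g \<theta> c p - k *\<^sub>R g c p"
    using gauge at by (simp add: gauge_one_form_def k_def n_def a_def)
  have "metric_trace g (einstein g) c p = s - s / 2 * n"
    using metric_trace_add_multiple[OF at, where h = "einstein g" and u = "ricci g" and r = "- (s / 2)"]
    by (simp add: einstein_def s_def scal_def n_def)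
  moreover have "metric_trace g (einstein g) c p = metric_trace g (bianchi_adj g \<theta>) c p - k * n"
    using metric_trace_add_multiple[OF at, where h = "einstein g" and u = "bianchi_adj g \<theta>" and r = "- k"]
    by (simp add: eq n_def)
  moreover have "metric_trace g (bianchi_adj g \<theta>) c p = - d + d / 2 * n"
    using metric_trace_add_multiple[OF at, where h = "bianchi_adj g \<theta>" and u = "codiff_adj g \<theta>" and r = "d / 2"]
      metric_trace_codiff_adj[OF at]
    by (simp add: bianchi_adj_def d_def n_def)
  moreover have "k * n = (n - 2) * a / 2"
    using n(1) by (simp add: k_def)
  ultimately have "(n - 2) * (d + s - a) = 0"
    by (simp add: field_simps)
  then have d: "d = a - s"
    using n(2) by simp
  have "codiff_adj g \<theta> c p = ricci g c p + (k - s / 2 - d / 2) *\<^sub>R g c p"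
    using eq by (simp add: einstein_def bianchi_adj_def s_def d_def algebra_simps)
  moreover have "k - s / 2 - d / 2 = - (a / n)"
    using n(1) by (simp add: d k_def field_simps)
  ultimately show ?thesis
    by (simp add: a_def n_def)
qed


section \<open>One-forms, covariant derivatives and Killing fields\<close>

lemma smooth_one_form_differential:
  assumes "smooth_function A f"
  shows "smooth_one_form A (differential f)"
  unfolding smooth_one_form_def
proof (intro conjI ballI allI)
  show "smooth_in_chart c (\<lambda>p. differential f c p $ i)" if "c \<in> A" for c i
    using smooth_in_chart_pd[OF is_chart_atlas[OF that]] assms that
    by (simp add: differential_def smooth_function_def)
next
  fix c c' p i
  assume "c \<in> A" "c' \<in> A" "p \<in> dom_chart c \<inter> dom_chart c'"
  then show "differential f c p $ i = (\<Sum>a\<in>UNIV. differential f c' p $ a * Defs.jacobian c c' p $ a $ i)"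
    using atlas assms
    by (simp add: differential_def smooth_atlas_def smooth_function_def pd_change_of_chart[of X c c'])
qed

lemma smooth_one_form_add:
  assumes "smooth_one_form A \<theta>" "smooth_one_form A \<omega>"
  shows "smooth_one_form A (\<lambda>c p. \<theta> c p + \<omega> c p)"
  using assms unfolding smooth_one_form_def
  by (simp add: smooth_in_chart_add[OF is_chart_atlas] distrib_right sum.distrib)

lemma cov_deriv_add:
  assumes "smooth_one_form A \<theta>" "smooth_one_form A \<omega>" "c \<in> A" "p \<in> dom_chart c"
  shows "cov_deriv g (\<lambda>c p. \<theta> c p + \<omega> c p) c p = cov_deriv g \<theta> c p + cov_deriv g \<omega> c p"
  using assms
  by (simp add: vec_eq_iff cov_deriv_def smooth_one_form_def pd_add distrib_left sum.distrib)

text \<open>\<open>\<Gamma>\<^sup>k\<^sub>i\<^sub>j \<eta>\<^sub>k\<close> is the Christoffel symbol of the first kind contracted with \<open>\<eta>\<^sup>#\<close>.\<close>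

lemma christoffel_contract:
  assumes "c \<in> A" "p \<in> dom_chart c"
  shows "(\<Sum>k\<in>UNIV. christoffel g c p k i j * \<eta> c p $ k) = (\<Sum>l\<in>UNIV. sharp g \<eta> c p $ l *
      (pd c i (\<lambda>q. g c q $ j $ l) p + pd c j (\<lambda>q. g c q $ i $ l) p - pd c l (\<lambda>q. g c q $ i $ j) p) / 2)"
proof -
  define D where "D = (\<lambda>l. pd c i (\<lambda>q. g c q $ j $ l) p + pd c j (\<lambda>q. g c q $ i $ l) p
    - pd c l (\<lambda>q. g c q $ i $ j) p)"
  have "(\<Sum>k\<in>UNIV. christoffel g c p k i j * \<eta> c p $ k)
      = (\<Sum>k\<in>UNIV. \<Sum>l\<in>UNIV. matrix_inv (g c p) $ l $ k * \<eta> c p $ k * D l / 2)"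
    by (simp add: christoffel_def D_def sum_distrib_left sum_distrib_right sum_divide_distrib
        inverse_metric_sym[OF assms, of _ k for k] mult_ac)
  also have "\<dots> = (\<Sum>l\<in>UNIV. \<Sum>k\<in>UNIV. matrix_inv (g c p) $ l $ k * \<eta> c p $ k * D l / 2)"
    by (rule sum.swap)
  also have "\<dots> = (\<Sum>l\<in>UNIV. sharp g \<eta> c p $ l * D l / 2)"
    by (simp add: sharp_def matrix_vector_mult_def sum_distrib_right sum_divide_distrib)
  finally show ?thesis by (simp add: D_def)
qed

text \<open>Differentiate \<open>\<eta>\<^sub>j = g\<^sub>j\<^sub>k V\<^sup>k\<close> by the Leibniz rule, where \<open>V = \<eta>\<^sup>#\<close>. In
  \<open>\<nabla>\<^sub>i\<eta>\<^sub>j + \<nabla>\<^sub>j\<eta>\<^sub>i\<close> the terms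
  \<open>V\<^sup>k \<partial>\<^sub>i g\<^sub>j\<^sub>k\<close> and \<open>V\<^sup>k \<partial>\<^sub>j g\<^sub>i\<^sub>k\<close> cancel against the Christoffel terms, which leave
  \<open>V\<^sup>k \<partial>\<^sub>k g\<^sub>i\<^sub>j\<close>.\<close>

lemma lie_deriv_metric_sharp:
  assumes "smooth_one_form A \<eta>" "c \<in> A" "p \<in> dom_chart c"
  shows "lie_deriv_metric g (sharp g \<eta>) c p = 2 *\<^sub>R codiff_adj g \<eta> c p"
proof -
  note chart = is_chart_atlas[OF assms(2)]
  note smooth = smooth_metric[OF assms(2)] smooth_in_chart_sharp[OF assms(1,2)]
  define V where "V = sharp g \<eta> c"
  define DV where "DV = (\<lambda>i k. pd c i (\<lambda>q. V q $ k) p)"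
  define Dg where "Dg = (\<lambda>i j k. pd c i (\<lambda>q. g c q $ j $ k) p)"
  have Dg_sym: "Dg i j k = Dg i k j" for i j k
    unfolding Dg_def by (rule pd_cong[OF chart assms(3)]) (rule metric_sym[OF assms(2)])
  have D\<eta>: "pd c i (\<lambda>q. \<eta> c q $ j) p = (\<Sum>k\<in>UNIV. g c p $ j $ k * DV i k + Dg i j k * V p $ k)" for i j
  proof -
    have "pd c i (\<lambda>q. \<eta> c q $ j) p = pd c i (\<lambda>q. \<Sum>k\<in>UNIV. g c q $ j $ k * V q $ k) p"
    proof (rule pd_cong[OF chart assms(3)])
      show "\<eta> c q $ j = (\<Sum>k\<in>UNIV. g c q $ j $ k * V q $ k)" if "q \<in> dom_chart c" for q
        using metric_mult_sharp[OF assms(2) that, of \<eta>] by (simp add: V_def matrix_vector_mult_def vec_eq_iff)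
    qed
    also have "\<dots> = (\<Sum>k\<in>UNIV. pd c i (\<lambda>q. g c q $ j $ k * V q $ k) p)"
      using smooth assms(3) by (intro pd_sum) (auto simp: V_def intro: smooth_in_chart_mult[OF chart])
    also have "\<dots> = (\<Sum>k\<in>UNIV. g c p $ j $ k * DV i k + Dg i j k * V p $ k)"
      using smooth assms(3) by (simp add: pd_mult[OF chart] DV_def Dg_def V_def)
    finally show ?thesis .
  qed
  have D: "cov_deriv g \<eta> c p $ i $ j = (\<Sum>k\<in>UNIV. g c p $ j $ k * DV i k + Dg i j k * V p $ k
      - V p $ k * (Dg i j k + Dg j i k - Dg k i j) / 2)" for i j
    using christoffel_contract[OF assms(2,3), of i j \<eta>] D\<eta>[of i j]
    by (simp add: cov_deriv_def Dg_def V_def sum_subtractf)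
  have "lie_deriv_metric g (sharp g \<eta>) c p $ i $ j = (2 *\<^sub>R codiff_adj g \<eta> c p) $ i $ j" for i j
  proof -
    have "(2 *\<^sub>R codiff_adj g \<eta> c p) $ i $ j = cov_deriv g \<eta> c p $ i $ j + cov_deriv g \<eta> c p $ j $ i"
      by (simp add: codiff_adj_def)
    also have "\<dots> = (\<Sum>k\<in>UNIV. V p $ k * Dg k i j + g c p $ k $ j * DV i k + g c p $ i $ k * DV j k)"
      unfolding D sum.distrib[symmetric]
      by (rule sum.cong)
        (simp_all add: Dg_sym[of _ j i] metric_sym[OF assms(2,3), of j] field_simps)
    finally show ?thesis
      by (simp add: lie_deriv_metric_def DV_def Dg_def V_def)
  qed
  then show ?thesis by (simp add: vec_eq_iff)
qed

end


section \<open>Gauge one-forms of gradient Ricci solitons\<close>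

theorem corollary4p3:
  fixes X :: "'a topology"
    and A :: "('a, 'n::finite) chart set"
    and g :: "('a, 'n) mat_field"
    and \<theta> :: "('a, 'n) vec_field"
    and f :: "'a \<Rightarrow> real"
    and lam :: real
  assumes "CARD('n) \<ge> 3"
    and "compact_manifold X A"
    and "harmonic_critical X A g"
    and "gauge_one_form X A g \<theta>"
    and "smooth_function A f"
    and "lam = avg_scal X A g / real CARD('n)"
    and "\<forall>c\<in>A. \<forall>p\<in>dom_chart c. ricci g c p + hess g f c p = lam *\<^sub>R g c p"
  shows "\<exists>\<eta>. smooth_one_form A \<eta> \<and>
           (\<forall>c\<in>A. \<forall>p\<in>dom_chart c. \<theta> c p = - differential f c p + \<eta> c p) \<and>
           killing_field A g (sharp g \<eta>)"
proof -
  interpret riemannian_atlas X A g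
    using assms(2,3) by unfold_locales (simp_all add: compact_manifold_def harmonic_critical_def)
  define \<eta> where "\<eta> = (\<lambda>c p. \<theta> c p + differential f c p)"
  have forms: "smooth_one_form A \<theta>" "smooth_one_form A (differential f)"
    using assms(4,5) smooth_one_form_differential by (auto simp: gauge_one_form_def)
  then have \<eta>: "smooth_one_form A \<eta>"
    unfolding \<eta>_def by (rule smooth_one_form_add)
  have "lie_deriv_metric g (sharp g \<eta>) c p = 0" if at: "c \<in> A" "p \<in> dom_chart c" for c p
  proof -
    have ricci: "codiff_adj g \<theta> c p = ricci g c p - lam *\<^sub>R g c p"
      using gauge_one_form_codiff_adj[OF assms(4) _ at] assms(1,6) by simp
    have soliton: "ricci g c p + hess g f c p = lam *\<^sub>R g c p"
      using assms(7) at by blast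
    (* In particular the Hessian is symmetric, so that symmetrizing it below changes nothing. *)
    have hess: "hess g f c p = - codiff_adj g \<theta> c p"
      unfolding ricci using soliton by (simp add: eq_diff_eq add.commute)
    have "codiff_adj g \<eta> c p $ i $ j = 0" for i j
    proof -
      have "cov_deriv g \<eta> c p $ k $ l = cov_deriv g \<theta> c p $ k $ l - codiff_adj g \<theta> c p $ k $ l" for k l
        using cov_deriv_add[OF forms at] hess by (simp add: \<eta>_def hess_def)
      from this[of i j] this[of j i] show ?thesis by (simp add: codiff_adj_def field_simps)
    qed
    then show ?thesis
      by (simp add: lie_deriv_metric_sharp[OF \<eta> at] vec_eq_iff)
  qed
  then have "killing_field A g (sharp g \<eta>)"
    using smooth_vector_field_sharp[OF \<eta>] by (simp add: killing_field_def)
  then show ?thesis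
    using \<eta> by (intro exI[of _ \<eta>]) (simp add: \<eta>_def)
qed

end
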